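(* Let $\mathcal{Y}=\{0,1\}$ and let $P_{XY}$ be a probability distribution on $\mathcal{X}\times\mathcal{Y}$ with $p=\Pr[Y=1]>0$. Let $D:\{1,2,\ldots\}\to[0,\infty)$ be a nonincreasing discount function such that $\sum_{r=1}^\infty D(r)$ is unbounded (diverges). Suppose $k=k(n)$ satisfies $k=o(n)$ and $k\to\infty$ as $n\to\infty$. Let $\tilde D(r)=D(r)$ for all $r\le k$ and $\tilde D(r)=0$ for all $r>k$. Let $f:\mathcal{X}\to\mathbb{R}$ be a ranking function such that $f(X)$ has an atomless distribution and $\overline{y}^f(s)=\Pr[Y=1\mid\tilde f(X)=s]$ is a continuous function of $s\in[0,1]$. Then, as $n\to\infty$, $$\mathrm{NDCG}_{\tilde D}(f,S_n)\overset{p}{\to}\overline{y}^f(1)=\Pr[Y=1\mid\tilde f(X)=1],$$ where $\overset{p}{\to}$ denotes convergence in probability.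
   Context: $(X,Y)\sim P_{XY}$; $(x_1,y_1),(x_2,y_2),\ldots$ are i.i.d. from $P_{XY}$ and $S_n=\{(x_1,y_1),\ldots,(x_n,y_n)\}$. A ranking function is a measurable map $f:\mathcal{X}\to\mathbb{R}$. It orders $x_1,\ldots,x_n$ by decreasing score, giving $x^f_{(1)},\ldots,x^f_{(n)}$ with $f(x^f_{(1)})\ge\cdots\ge f(x^f_{(n)})$, ties being broken by a fixed rule not depending on the labels; $y^f_{(r)}$ denotes the label of $x^f_{(r)}$. For a discount $D$ (possibly depending on $n$), $\mathrm{DCG}_D(f,S_n)=\sum_{r=1}^n y^f_{(r)}D(r)$; $\mathrm{IDCG}_D(S_n)$ is the maximum of this sum over all orderings of the $n$ items; $\mathrm{NDCG}_D(f,S_n)=\mathrm{DCG}_D(f,S_n)/\mathrm{IDCG}_D(S_n)$ (equal to $1$ by convention when $\mathrm{IDCG}_D(S_n)=0$). The canonical version of $f$ is $\tilde f(x)=\Pr_{X\sim P_X}[f(X)\le f(x)]$; when $f(X)$ is atomless, $\tilde f(X)$ is uniform on $[0,1]$. The value $\Pr[Y=1\mid\tilde f(X)=1]$ is understood via the continuous version $\overline{y}^f$. *)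

theory Defs
  imports "HOL-Probability.Probability" "HOL-Library.Landau_Symbols"
begin

text \<open>
  A sample is a sequence \<open>z\<close> of pairs (item, label), of which the entries \<open>z 1, \<dots>, z n\<close> form
  \<open>S\<^sub>n\<close>. Labels are real numbers; the data distribution lives on
  \<open>X \<Otimes>\<^sub>M count_space {0, 1}\<close>. Discounts are functions on \<open>{1, 2, \<dots>}\<close>; their value at \<open>0\<close>
  is never used.
\<close>

text \<open>
  An ordering rule for the scores \<open>f\<close>: from the items \<open>x 1, \<dots>, x n\<close> alone (no labels) it
  computes the permutation sending the rank \<open>r\<close> to the index of the item placed at rank \<open>r\<close>. Where
  scores are distinct it is determined by \<open>f\<close>; the freedom is exactly the choice of how ties are
  broken. Measurability makes the induced label sequence a sequence of random variables.
\<close>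

definition score_ordering ::
    "'x measure \<Rightarrow> ('x \<Rightarrow> real) \<Rightarrow> (nat \<Rightarrow> (nat \<Rightarrow> 'x) \<Rightarrow> nat \<Rightarrow> nat) \<Rightarrow> bool" where
  "score_ordering X f \<sigma> \<longleftrightarrow>
     (\<forall>n. \<forall>x \<in> space (PiM {1..n} (\<lambda>_. X)).
        \<sigma> n x permutes {1..n} \<and>
        (\<forall>r \<in> {1..n}. \<forall>s \<in> {1..n}. r \<le> s \<longrightarrow> f (x (\<sigma> n x s)) \<le> f (x (\<sigma> n x r)))) \<and>
     (\<forall>n. \<forall>r \<in> {1..n}. (\<lambda>x. \<sigma> n x r) \<in> measurable (PiM {1..n} (\<lambda>_. X)) (count_space UNIV))"

definition ranked_label ::
    "(nat \<Rightarrow> (nat \<Rightarrow> 'x) \<Rightarrow> nat \<Rightarrow> nat) \<Rightarrow> nat \<Rightarrow> (nat \<Rightarrow> 'x \<times> real) \<Rightarrow> nat \<Rightarrow> real" where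
  "ranked_label \<sigma> n z r = snd (z (\<sigma> n (restrict (\<lambda>i. fst (z i)) {1..n}) r))"

definition DCG ::
    "(nat \<Rightarrow> real) \<Rightarrow> (nat \<Rightarrow> (nat \<Rightarrow> 'x) \<Rightarrow> nat \<Rightarrow> nat) \<Rightarrow> nat \<Rightarrow> (nat \<Rightarrow> 'x \<times> real) \<Rightarrow> real" where
  "DCG D \<sigma> n z = (\<Sum>r = 1..n. ranked_label \<sigma> n z r * D r)"

definition IDCG :: "(nat \<Rightarrow> real) \<Rightarrow> nat \<Rightarrow> (nat \<Rightarrow> 'x \<times> real) \<Rightarrow> real" where
  "IDCG D n z = Max {(\<Sum>r = 1..n. snd (z (\<pi> r)) * D r) | \<pi>. \<pi> permutes {1..n}}"

definition NDCG ::
    "(nat \<Rightarrow> real) \<Rightarrow> (nat \<Rightarrow> (nat \<Rightarrow> 'x) \<Rightarrow> nat \<Rightarrow> nat) \<Rightarrow> nat \<Rightarrow> (nat \<Rightarrow> 'x \<times> real) \<Rightarrow> real" where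
  "NDCG D \<sigma> n z = (if IDCG D n z = 0 then 1 else DCG D \<sigma> n z / IDCG D n z)"

definition cutoff :: "nat \<Rightarrow> (nat \<Rightarrow> real) \<Rightarrow> nat \<Rightarrow> real" where
  "cutoff k D r = (if r \<le> k then D r else 0)"

definition canonical :: "('x \<times> real) measure \<Rightarrow> ('x \<Rightarrow> real) \<Rightarrow> 'x \<Rightarrow> real" where
  "canonical P f x = measure P {z \<in> space P. f (fst z) \<le> f x}"

text \<open>
  \<open>\<eta>\<close> is a version of \<open>s \<mapsto> Pr[Y = 1 | canonical score of X = s]\<close>: composed with the canonical
  score it is the conditional probability given the sigma-algebra which that score generates.
  Such a version is in general determined only almost everywhere, but there is at most one that is
  continuous on \<open>{0..1}\<close> if the score is atomless.
\<close>

definition cond_label_prob ::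
    "('x \<times> real) measure \<Rightarrow> ('x \<Rightarrow> real) \<Rightarrow> (real \<Rightarrow> real) \<Rightarrow> bool" where
  "cond_label_prob P f \<eta> \<longleftrightarrow>
     (AE z in P.
        real_cond_exp P (vimage_algebra (space P) (\<lambda>z. canonical P f (fst z)) borel)
          (indicator {z \<in> space P. snd z = 1}) z = \<eta> (canonical P f (fst z)))"

definition tendsto_in_prob :: "'w measure \<Rightarrow> (nat \<Rightarrow> 'w \<Rightarrow> real) \<Rightarrow> real \<Rightarrow> bool" where
  "tendsto_in_prob M V c \<longleftrightarrow>
     (\<forall>n. V n \<in> borel_measurable M) \<and>
     (\<forall>\<epsilon>>0. (\<lambda>n. measure M {\<omega> \<in> space M. \<bar>V n \<omega> - c\<bar> > \<epsilon>}) \<longlonglongrightarrow> 0)"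

end

theory Submission
  imports Defs "HOL-Real_Asymp.Real_Asymp"
begin

text \<open>
  Write \<open>T\<close> for the canonical score and \<open>W = (\<Sum>r = 1..k. D r)\<close>. Almost surely no two items have the
  same canonical score, so the DCG is a sum over the items, the label \<open>Y\<^sub>i\<close> having the weight
  \<open>w\<^sub>i\<close> that the discount gives to the rank of \<open>T\<^sub>i\<close>; these weights are functions of the canonical
  scores alone and add up to \<open>W\<close>. Since \<open>Y\<^sub>i - \<eta> (T\<^sub>i)\<close> is orthogonal to every bounded
  function of \<open>T\<^sub>i\<close>, integrating out one observation kills the cross terms in the second moment of
  \<open>\<Sum>i. w\<^sub>i (Y\<^sub>i - \<eta> (T\<^sub>i))\<close>, which is therefore at most a constant times
  \<open>\<Sum>r = 1..k. (D r)\<^sup>2 \<le> D 1 * W\<close>. As \<open>W\<close> diverges, this noise is negligible against \<open>W\<close>. Because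
  \<open>k = o(n)\<close>, with high probability at least \<open>k\<close> items have a canonical score close to \<open>1\<close>, so that only
  such items carry weight and \<open>\<eta> (T\<^sub>i)\<close> may be replaced by \<open>\<eta> 1\<close>; and at least \<open>k\<close> labels are \<open>1\<close>,
  so that the IDCG equals \<open>W\<close>.
\<close>

subsection \<open>Ranks\<close>

text \<open>The rank is computed from the scores alone: neither labels nor the tie-breaking rule
  enter. Ranks start at 1, and tied items share a rank, so \<open>score_rank\<close> inverts an
  ordering only where the scores are distinct.\<close>

definition score_rank :: "nat \<Rightarrow> (nat \<Rightarrow> real) \<Rightarrow> nat \<Rightarrow> nat" where
  "score_rank n t i = Suc (card {j \<in> {1..n}. t i < t j})"

text \<open>Distinctness turns the weak inequalities of a sorted list into strict ones. The items
  that beat the one placed at \<open>r\<close> are then exactly those at the ranks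
  \<open>1, ..., r - 1\<close>.\<close>

lemma score_rank_of_sorting:
  assumes \<pi>: "\<pi> permutes {1..n}" and inj: "inj_on t {1..n}"
    and sorted: "\<And>r s. r \<in> {1..n} \<Longrightarrow> s \<in> {1..n} \<Longrightarrow> r \<le> s \<Longrightarrow> t (\<pi> s) \<le> t (\<pi> r)"
    and r: "r \<in> {1..n}"
  shows "score_rank n t (\<pi> r) = r"
proof -
  have lt: "t (\<pi> r) < t (\<pi> s) \<longleftrightarrow> s < r" if s: "s \<in> {1..n}" for s
  proof
    assume "t (\<pi> r) < t (\<pi> s)"
    then show "s < r"
      using sorted[OF r s] by fastforce
  next
    assume "s < r"
    moreover have "t (\<pi> s) \<noteq> t (\<pi> r)"
      using inj \<open>s < r\<close> permutes_inj[OF \<pi>] permutes_in_image[OF \<pi>] r s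
      by (metis inj_eq inj_onD nat_neq_iff)
    ultimately show "t (\<pi> r) < t (\<pi> s)"
      using sorted[OF s r] by simp
  qed
  have "{j \<in> {1..n}. t (\<pi> r) < t j} = {j \<in> \<pi> ` {1..n}. t (\<pi> r) < t j}"
    by (simp only: permutes_image[OF \<pi>])
  also have "\<dots> = \<pi> ` {s \<in> {1..n}. t (\<pi> r) < t (\<pi> s)}"
    by auto
  also have "{s \<in> {1..n}. t (\<pi> r) < t (\<pi> s)} = {1..<r}"
    using lt r by auto
  finally have "card {j \<in> {1..n}. t (\<pi> r) < t j} = card {1..<r}"
    using permutes_inj[OF \<pi>] by (simp add: card_image inj_on_subset)
  then show ?thesis
    using r by (simp add: score_rank_def)
qed

text \<open>This passes from summing over ranks to summing over items, where independence can be
  used. The summand \<open>a\<close> sees both the item and its rank, so the DCG and the total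
  weight are both instances.\<close>

lemma sum_sorting_eq_sum_score_rank:
  fixes a :: "nat \<Rightarrow> nat \<Rightarrow> real"
  assumes "\<pi> permutes {1..n}" and "inj_on t {1..n}"
    and "\<And>r s. r \<in> {1..n} \<Longrightarrow> s \<in> {1..n} \<Longrightarrow> r \<le> s \<Longrightarrow> t (\<pi> s) \<le> t (\<pi> r)"
  shows "(\<Sum>r = 1..n. a (\<pi> r) r) = (\<Sum>i = 1..n. a i (score_rank n t i))"
proof -
  have "(\<Sum>i = 1..n. a i (score_rank n t i)) = (\<Sum>r = 1..n. a (\<pi> r) (score_rank n t (\<pi> r)))"
    using sum.permute[OF assms(1), of "\<lambda>i. a i (score_rank n t i)"] by (simp add: o_def)
  also have "\<dots> = (\<Sum>r = 1..n. a (\<pi> r) r)"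
    using score_rank_of_sorting[OF assms] by (intro sum.cong) auto
  finally show ?thesis ..
qed

text \<open>Points of a product space are extensional functions, so measurability is stated for
  restricted score vectors. The rank of an item in the range reads no score outside it.\<close>

lemma score_rank_restrict:
  "i \<in> {1..n} \<Longrightarrow> score_rank n (\<lambda>i\<in>{1..n}. t i) i = score_rank n t i"
  by (simp add: score_rank_def cong: conj_cong)

text \<open>A larger score gives a strictly smaller rank, which yields injectivity. No item counts
  itself, so ranks stay at most \<open>n\<close>, and an injective map of a finite set into itself
  is onto. Hence the weights of the items are the discounts in another order.\<close>

lemma bij_betw_score_rank:
  assumes inj: "inj_on t {1..n}"
  shows "bij_betw (score_rank n t) {1..n} {1..n}"
proof -
  have less: "score_rank n t j < score_rank n t i" if "t i < t j" "j \<in> {1..n}" for i j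
    unfolding score_rank_def Suc_less_eq using that by (intro psubset_card_mono) auto
  have "inj_on (score_rank n t) {1..n}"
  proof (rule inj_onI)
    fix i j assume ij: "i \<in> {1..n}" "j \<in> {1..n}" "score_rank n t i = score_rank n t j"
    then have "t i = t j"
      using less[of i j] less[of j i] by fastforce
    then show "i = j"
      using inj ij by (auto dest: inj_onD)
  qed
  moreover have "score_rank n t ` {1..n} \<subseteq> {1..n}"
  proof clarify
    fix i assume i: "i \<in> {1..n}"
    have "card {j \<in> {1..n}. t i < t j} \<le> card ({1..n} - {i})"
      by (intro card_mono) auto
    also have "\<dots> = n - 1"
      using i by simp
    finally have "card {j \<in> {1..n}. t i < t j} \<le> n - 1" .
    moreover have "1 \<le> n"
      using i by simp
    ultimately show "score_rank n t i \<in> {1..n}"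
      unfolding score_rank_def atLeastAtMost_iff by linarith
  qed
  ultimately show ?thesis
    by (simp add: bij_betw_def endo_inj_surj)
qed

lemma measurable_score_rank:
  assumes "i \<in> {1..n}"
  shows "(\<lambda>t. score_rank n t i) \<in> measurable (PiM {1..n} (\<lambda>_. borel)) (count_space UNIV)"
proof -
  have "(\<lambda>t. card {j. j \<in> {1..n} \<and> t i < t j})
      \<in> measurable (PiM {1..n} (\<lambda>_. borel :: real measure)) (count_space UNIV)"
  proof (rule measurable_card)
    fix j
    show "{t \<in> space (PiM {1..n} (\<lambda>_. borel :: real measure)). j \<in> {j. j \<in> {1..n} \<and> t i < t j}}
        \<in> sets (PiM {1..n} (\<lambda>_. borel))"
    proof (cases "j \<in> {1..n}")
      case True
      have [measurable]: "(\<lambda>t. t i) \<in> borel_measurable (PiM {1..n} (\<lambda>_. borel :: real measure))"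
          "(\<lambda>t. t j) \<in> borel_measurable (PiM {1..n} (\<lambda>_. borel :: real measure))"
        using True assms by (auto intro: measurable_component_singleton)
      have "{t \<in> space (PiM {1..n} (\<lambda>_. borel :: real measure)). t i < t j} \<in> sets (PiM {1..n} (\<lambda>_. borel))"
        by measurable
      with True show ?thesis
        by simp
    next
      case False
      have "{t \<in> space (PiM {1..n} (\<lambda>_. borel :: real measure)). j \<in> {j. j \<in> {1..n} \<and> t i < t j}} = {}"
        using False by blast
      then show ?thesis
        by (simp only: sets.empty_sets)
    qed
  qed
  then have "(\<lambda>t. Suc (card {j \<in> {1..n}. t i < t j}))
      \<in> measurable (PiM {1..n} (\<lambda>_. borel :: real measure)) (count_space UNIV)"
    by measurable
  then show ?thesis
    by (simp only: score_rank_def)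
qed

text \<open>If the score were at most \<open>c\<close>, all of the \<open>k\<close> or more items
  above \<open>c\<close> would outrank it and push its rank beyond \<open>k\<close>.\<close>

lemma score_gt_of_score_rank_le:
  assumes "k \<le> card {j \<in> {1..n}. c < t j}" and "score_rank n t i \<le> k"
  shows "c < t i"
proof (rule ccontr)
  assume "\<not> c < t i"
  then have "{j \<in> {1..n}. c < t j} \<subseteq> {j \<in> {1..n}. t i < t j}"
    by auto
  then have "card {j \<in> {1..n}. c < t j} \<le> card {j \<in> {1..n}. t i < t j}"
    by (intro card_mono) auto
  with assms show False
    by (simp add: score_rank_def)
qed

section \<open>Truncated discounts and their ideal DCG\<close>

lemma sum_cutoff:
  assumes "k \<le> n"
  shows "(\<Sum>r = 1..n. g (cutoff k D r)) = (\<Sum>r = 1..k. g (D r)) + real (n - k) * (g 0 :: real)"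
proof -
  have "(\<Sum>r = 1..n. g (cutoff k D r)) =
      (\<Sum>r \<in> {1..k} \<union> {k<..n}. g (cutoff k D r))"
    using assms by (intro sum.cong) auto
  also have "\<dots> = (\<Sum>r \<in> {1..k}. g (cutoff k D r)) + (\<Sum>r \<in> {k<..n}. g (cutoff k D r))"
    by (intro sum.union_disjoint) auto
  also have "(\<Sum>r \<in> {1..k}. g (cutoff k D r)) = (\<Sum>r = 1..k. g (D r))"
    by (intro sum.cong) (auto simp: cutoff_def)
  also have "(\<Sum>r \<in> {k<..n}. g (cutoff k D r)) = (\<Sum>r \<in> {k<..n}. g 0)"
    by (intro sum.cong) (auto simp: cutoff_def)
  finally show ?thesis
    by simp
qed

lemma sum_indicator_eq_card_hits:
  "(\<Sum>i = 1..n::nat. indicat_real A (z i)) = real (card {i \<in> {1..n}. z i \<in> A})"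
  by (simp add: indicator_def sum.If_cases Int_def)

text \<open>Labels are at most 1, so no ordering beats the full discount sum. An ordering that
  starts with \<open>k\<close> items labelled 1 attains it, because all later ranks have discount
  0.\<close>

lemma IDCG_cutoff:
  assumes labels: "\<And>i. i \<in> {1..n} \<Longrightarrow> snd (z i) \<in> {0, 1}"
    and ones: "k \<le> card {i \<in> {1..n}. snd (z i) = 1}"
    and D: "\<And>r. 1 \<le> r \<Longrightarrow> 0 \<le> D r"
  shows "IDCG (cutoff k D) n z = (\<Sum>r = 1..k. D r)"
proof -
  let ?V = "{(\<Sum>r = 1..n. snd (z (\<pi> r)) * cutoff k D r) | \<pi>. \<pi> permutes {1..n}}"
  have "card {i \<in> {1..n}. snd (z i) = 1} \<le> card {1..n}"
    by (intro card_mono) auto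
  with ones have kn: "k \<le> n"
    by simp
  obtain S where S: "S \<subseteq> {i \<in> {1..n}. snd (z i) = 1}" "card S = k" "finite S"
    using obtain_subset_with_card_n[OF ones] by blast
  have "card ({1..n} - S) = card {k<..n}"
    using S by (subst card_Diff_subset) auto
  then obtain g where g: "bij_betw g {k<..n} ({1..n} - S)"
    using finite_same_card_bij[of "{k<..n}" "{1..n} - S"] by auto
  obtain h where h: "bij_betw h {1..k} S"
    using finite_same_card_bij[of "{1..k}" S] S by auto
  \<comment> \<open>The optimal ordering: \<open>k\<close> chosen items labelled 1 fill the first
    \<open>k\<close> ranks, the other items follow in any order, and everything outside
    \<open>{1..n}\<close> is fixed, as \<open>permutes\<close> demands.\<close>
  define \<pi> where "\<pi> r = (if r \<in> {1..k} then h r else if r \<in> {k<..n} then g r else r)" for r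
  have "bij_betw \<pi> {1..k} S" "bij_betw \<pi> {k<..n} ({1..n} - S)"
    using h g by (auto simp: \<pi>_def elim!: bij_betw_cong[THEN iffD1, rotated])
  then have "bij_betw \<pi> ({1..k} \<union> {k<..n}) (S \<union> ({1..n} - S))"
    by (rule bij_betw_combine) auto
  moreover have "{1..k} \<union> {k<..n} = {1..n}" "S \<union> ({1..n} - S) = {1..n}"
    using kn S by auto
  ultimately have "\<pi> permutes {1..n}"
    using kn by (intro bij_imp_permutes) (auto simp: \<pi>_def)
  moreover have "(\<Sum>r = 1..n. snd (z (\<pi> r)) * cutoff k D r) = (\<Sum>r = 1..n. cutoff k D r)"
  proof (intro sum.cong refl)
    fix r assume "r \<in> {1..n}"
    then show "snd (z (\<pi> r)) * cutoff k D r = cutoff k D r"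
      using S(1) bij_betw_apply[OF h, of r] by (auto simp: \<pi>_def cutoff_def)
  qed
  ultimately have mem: "(\<Sum>r = 1..n. cutoff k D r) \<in> ?V"
    by (intro CollectI exI[of _ \<pi>]) simp
  have le: "v \<le> (\<Sum>r = 1..n. cutoff k D r)" if v: "v \<in> ?V" for v
  proof -
    obtain \<pi> where \<pi>: "\<pi> permutes {1..n}" and v: "v = (\<Sum>r = 1..n. snd (z (\<pi> r)) * cutoff k D r)"
      using v by auto
    have "snd (z (\<pi> r)) * cutoff k D r \<le> cutoff k D r" if "r \<in> {1..n}" for r
      using labels[of "\<pi> r"] D[of r] that permutes_in_image[OF \<pi>, of r] by (auto simp: cutoff_def)
    then show ?thesis
      unfolding v by (intro sum_mono)
  qed
  have "finite ?V"
    by (simp add: finite_permutations)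
  then have "IDCG (cutoff k D) n z = (\<Sum>r = 1..n. cutoff k D r)"
    unfolding IDCG_def using mem le by (intro Max_eqI) auto
  also have "\<dots> = (\<Sum>r = 1..k. D r)"
    using sum_cutoff[OF kn, of "\<lambda>x. x" D] by simp
  finally show ?thesis .
qed

subsection \<open>Independent samples\<close>

locale iid_sample = prob_space M + P: prob_space P for M :: "'w measure" and P :: "'a measure" +
  fixes Z :: "nat \<Rightarrow> 'w \<Rightarrow> 'a"
  assumes indep: "indep_vars (\<lambda>_. P) Z {1..}"
    and distr_Z: "1 \<le> i \<Longrightarrow> distr M P (Z i) = P"
begin

lemma measurable_Z [measurable]: "1 \<le> i \<Longrightarrow> Z i \<in> measurable M P"
  using indep by (auto simp: indep_vars_def)

lemma distr_restrict_sample: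
  assumes "I \<subseteq> {1..}" and "I \<noteq> {}"
  shows "distr M (PiM I (\<lambda>_. P)) (\<lambda>\<omega>. \<lambda>i\<in>I. Z i \<omega>) = PiM I (\<lambda>_. P)"
proof -
  have "indep_vars (\<lambda>_. P) Z I"
    by (rule indep_vars_subset[OF indep assms(1)])
  then have "distr M (PiM I (\<lambda>_. P)) (\<lambda>\<omega>. \<lambda>i\<in>I. Z i \<omega>) = PiM I (\<lambda>i. distr M P (Z i))"
    using assms by (subst (asm) indep_vars_iff_distr_eq_PiM') auto
  also have "\<dots> = PiM I (\<lambda>_. P)"
    using assms(1) by (intro PiM_cong) (auto simp: subset_eq distr_Z)
  finally show ?thesis .
qed

text \<open>The sample has a product law, so by Fubini observation \<open>i\<close> may be
  integrated first while the others are frozen. Boundedness supplies the integrability.\<close>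

lemma expectation_eq_0_by_coordinate:
  fixes G :: "(nat \<Rightarrow> 'a) \<Rightarrow> real"
  assumes I: "finite I" "I \<subseteq> {1..}" "i \<in> I"
    and meas: "G \<in> borel_measurable (PiM I (\<lambda>_. P))"
    and bnd: "\<And>z. z \<in> space (PiM I (\<lambda>_. P)) \<Longrightarrow> \<bar>G z\<bar> \<le> B"
    and null: "\<And>z. z \<in> space (PiM (I - {i}) (\<lambda>_. P)) \<Longrightarrow> (\<integral>y. G (z(i := y)) \<partial>P) = 0"
  shows "expectation (\<lambda>\<omega>. G (\<lambda>i\<in>I. Z i \<omega>)) = 0"
proof -
  interpret PP: product_sigma_finite "\<lambda>_. P"
    by unfold_locales
  interpret PI: prob_space "PiM I (\<lambda>_. P)"
    by (intro prob_space_PiM P.prob_space_axioms)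
  have I': "insert i (I - {i}) = I"
    using I by auto
  have int: "integrable (PiM I (\<lambda>_. P)) G"
    using meas bnd by (intro PI.integrable_const_bound[of _ B]) auto
  have [measurable]: "(\<lambda>\<omega>. \<lambda>i\<in>I. Z i \<omega>) \<in> measurable M (PiM I (\<lambda>_. P))"
    using I by (intro measurable_restrict) auto
  have "expectation (\<lambda>\<omega>. G (\<lambda>i\<in>I. Z i \<omega>))
      = integral\<^sup>L (distr M (PiM I (\<lambda>_. P)) (\<lambda>\<omega>. \<lambda>i\<in>I. Z i \<omega>)) G"
    using meas by (subst integral_distr) auto
  also have "\<dots> = integral\<^sup>L (PiM (insert i (I - {i})) (\<lambda>_. P)) G"
    using I by (subst distr_restrict_sample) (auto simp: insert_absorb)
  also have "\<dots> = (\<integral>z. (\<integral>y. G (z(i := y)) \<partial>P) \<partial>PiM (I - {i}) (\<lambda>_. P))"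
    using I int by (intro PP.product_integral_insert) (auto simp: I' insert_absorb)
  also have "\<dots> = (\<integral>z. 0 \<partial>PiM (I - {i}) (\<lambda>_. P))"
    using null by (intro Bochner_Integration.integral_cong) auto
  finally show ?thesis
    by simp
qed

text \<open>Two independent observations have a product law. Once the first is fixed, the second
  hits its score with probability 0 because the score has no atoms; Fubini then gives the
  claim.\<close>

lemma AE_no_ties:
  fixes T :: "'a \<Rightarrow> real"
  assumes T [measurable]: "T \<in> borel_measurable P"
    and atomless: "\<And>t. measure P {z \<in> space P. T z = t} = 0"
    and ij: "1 \<le> i" "1 \<le> j" "i \<noteq> j"
  shows "AE \<omega> in M. T (Z i \<omega>) \<noteq> T (Z j \<omega>)"
proof -
  interpret PP: pair_prob_space P P
    by unfold_locales
  have "indep_var P (Z i) P (Z j)"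
  proof -
    \<comment> \<open>Independence of the whole family yields independence of disjoint blocks; the
      blocks are singletons here, and projecting them returns the single variables.\<close>
    have "indep_var (PiM {i} (\<lambda>_. P)) (\<lambda>\<omega>. \<lambda>i\<in>{i}. Z i \<omega>) (PiM {j} (\<lambda>_. P)) (\<lambda>\<omega>. \<lambda>i\<in>{j}. Z i \<omega>)"
      using ij by (intro indep_var_restrict[OF indep]) auto
    then have "indep_var P ((\<lambda>x. x i) \<circ> (\<lambda>\<omega>. \<lambda>i\<in>{i}. Z i \<omega>)) P ((\<lambda>x. x j) \<circ> (\<lambda>\<omega>. \<lambda>i\<in>{j}. Z i \<omega>))"
      by (rule indep_var_compose) auto
    then show ?thesis
      by (simp add: o_def)
  qed
  then have eq: "distr M (P \<Otimes>\<^sub>M P) (\<lambda>\<omega>. (Z i \<omega>, Z j \<omega>)) = P \<Otimes>\<^sub>M P"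
    unfolding indep_var_distribution_eq using ij by (simp add: distr_Z)
  have "AE w in P. T z \<noteq> T w" for z
  proof (rule AE_I')
    show "{w \<in> space P. T w = T z} \<in> null_sets P"
      using atomless by (intro null_setsI) (auto simp: P.emeasure_eq_measure)
  qed auto
  then have "AE x in P \<Otimes>\<^sub>M P. T (fst x) \<noteq> T (snd x)"
    by (intro PP.AE_pair_measure) auto
  then have "AE x in distr M (P \<Otimes>\<^sub>M P) (\<lambda>\<omega>. (Z i \<omega>, Z j \<omega>)). T (fst x) \<noteq> T (snd x)"
    by (simp only: eq)
  then show ?thesis
    using ij by (subst (asm) AE_distr_iff) auto
qed

lemma AE_inj_on_scores:
  fixes T :: "'a \<Rightarrow> real"
  assumes "T \<in> borel_measurable P"
    and "\<And>t. measure P {z \<in> space P. T z = t} = 0"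
  shows "AE \<omega> in M. inj_on (\<lambda>i. T (Z i \<omega>)) {1..n}"
proof -
  have "AE \<omega> in M. \<forall>i\<in>{1..n}. \<forall>j\<in>{1..n}. i \<noteq> j \<longrightarrow> T (Z i \<omega>) \<noteq> T (Z j \<omega>)"
    using AE_no_ties[OF assms] by (intro AE_finite_allI AE_impI) auto
  then show ?thesis
    by eventually_elim (auto simp: inj_on_def)
qed

section \<open>Concentration of hit counts and of rank-weighted noise\<close>

lemma few_hits_in_events:
  assumes [measurable]: "A \<in> sets P"
  shows "{\<omega> \<in> space M. card {i \<in> {1..n}. Z i \<omega> \<in> A} < k} \<in> events"
proof -
  have eq: "{\<omega> \<in> space M. card {i \<in> {1..n}. Z i \<omega> \<in> A} < k}
      = {\<omega> \<in> space M. (\<Sum>i = 1..n. indicat_real A (Z i \<omega>)) < real k}"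
    by (simp only: sum_indicator_eq_card_hits of_nat_less_iff)
  have "(\<lambda>\<omega>. \<Sum>i = 1..n. indicat_real A (Z i \<omega>)) \<in> borel_measurable M"
    by (intro borel_measurable_sum measurable_compose[OF measurable_Z]) auto
  then show ?thesis
    unfolding eq by measurable
qed

text \<open>The mean number of hits is \<open>n * q\<close> with \<open>q > 0\<close>, whereas
  \<open>k n\<close> is eventually at most half of that. Fewer than \<open>k n\<close> hits is thus
  a deviation of linear size, which Hoeffding makes exponentially unlikely.\<close>

lemma few_hits_tendsto_0:
  assumes A [measurable]: "A \<in> sets P" and pos: "0 < measure P A"
    and k: "(\<lambda>n. real (k n)) \<in> o(\<lambda>n. real n)"
  shows "(\<lambda>n. prob {\<omega> \<in> space M. card {i \<in> {1..n}. Z i \<omega> \<in> A} < k n}) \<longlonglongrightarrow> 0"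
proof (rule tendsto_sandwich[OF _ _ tendsto_const])
  define q where "q = measure P A"
  have q: "0 < q"
    using pos by (simp add: q_def)
  \<comment> \<open>The exponent is Hoeffding's for a deviation \<open>n * q / 2\<close> of
    \<open>n\<close> summands in \<open>[0, 1]\<close>:
    \<open>2 * (n * q / 2)^2 / n = q^2 / 2 * n\<close>.\<close>
  show "(\<lambda>n. exp (- (q\<^sup>2 / 2) * real n)) \<longlonglongrightarrow> 0"
    using q by real_asymp
  have "\<forall>\<^sub>F n in sequentially. norm (real (k n)) \<le> (q / 2) * norm (real n)"
    using landau_o.smallD[OF k, of "q / 2"] q by simp
  then show "\<forall>\<^sub>F n in sequentially.
      prob {\<omega> \<in> space M. card {i \<in> {1..n}. Z i \<omega> \<in> A} < k n} \<le> exp (- (q\<^sup>2 / 2) * real n)"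
    using eventually_gt_at_top[of 0]
  proof eventually_elim
    case (elim n)
    interpret H: Hoeffding_ineq M "{1..n}" "\<lambda>i \<omega>. indicator A (Z i \<omega>)" "\<lambda>_. 0" "\<lambda>_. 1" "real n * q"
    proof unfold_locales
      show "indep_vars (\<lambda>_. borel) (\<lambda>i \<omega>. indicator A (Z i \<omega>) :: real) {1..n}"
        by (rule indep_vars_compose2[OF indep_vars_subset[OF indep]]) auto
      have "expectation (\<lambda>\<omega>. indicat_real A (Z i \<omega>)) = q" if "i \<in> {1..n}" for i
      proof -
        have "expectation (\<lambda>\<omega>. indicat_real A (Z i \<omega>)) = (\<integral>z. indicat_real A z \<partial>distr M P (Z i))"
          using that by (subst integral_distr) auto
        also have "\<dots> = q"
          using that A by (simp add: distr_Z q_def)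
        finally show ?thesis .
      qed
      then show "real n * q \<equiv> \<Sum>i = 1..n. expectation (\<lambda>\<omega>. indicator A (Z i \<omega>))"
        by simp
    qed (auto simp: indicator_def)
    have "prob {\<omega> \<in> space M. card {i \<in> {1..n}. Z i \<omega> \<in> A} < k n}
        \<le> prob {\<omega> \<in> space M. (\<Sum>i = 1..n. indicator A (Z i \<omega>)) \<le> real n * q - real n * q / 2}"
    proof (intro finite_measure_mono)
      have "real (k n) \<le> real n * q - real n * q / 2"
        using elim by (simp add: mult.commute)
      then show "{\<omega> \<in> space M. card {i \<in> {1..n}. Z i \<omega> \<in> A} < k n}
          \<subseteq> {\<omega> \<in> space M. (\<Sum>i = 1..n. indicator A (Z i \<omega>)) \<le> real n * q - real n * q / 2}"
        unfolding sum_indicator_eq_card_hits by force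
    next
      have "(\<lambda>\<omega>. \<Sum>i = 1..n. indicat_real A (Z i \<omega>)) \<in> borel_measurable M"
        by (intro borel_measurable_sum measurable_compose[OF measurable_Z]) auto
      then show "{\<omega> \<in> space M. (\<Sum>i = 1..n. indicator A (Z i \<omega>)) \<le> real n * q - real n * q / 2} \<in> events"
        by measurable
    qed
    also have "\<dots> \<le> exp (- 2 * (real n * q / 2)\<^sup>2 / (\<Sum>i = 1..n. (1 - 0)\<^sup>2))"
      using elim q by (intro H.Hoeffding_ineq_le) auto
    also have "\<dots> = exp (- (q\<^sup>2 / 2) * real n)"
      using elim by (simp add: power2_eq_square field_simps)
    finally show ?case .
  qed
qed auto

text \<open>Each weight may depend on all scores, so the summands are dependent. Still, with all
  observations but \<open>i\<close> frozen, everything in a cross term except \<open>h (Z i)\<close>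
  is a bounded function of the score of \<open>i\<close>, and \<open>orth\<close> annihilates it.
  The diagonal is at most \<open>C^2\<close> times the sum of squared weights.\<close>

lemma second_moment_weighted_noise:
  fixes T h :: "'a \<Rightarrow> real" and W :: "nat \<Rightarrow> (nat \<Rightarrow> real) \<Rightarrow> real"
  assumes I: "finite I" "I \<subseteq> {1..}"
    and [measurable]: "T \<in> borel_measurable P" "h \<in> borel_measurable P"
    and W [measurable]: "\<And>i. i \<in> I \<Longrightarrow> W i \<in> borel_measurable (PiM I (\<lambda>_. borel))"
    and W_bnd: "\<And>i t. i \<in> I \<Longrightarrow> \<bar>W i t\<bar> \<le> B"
    and h_bnd: "\<And>z. z \<in> space P \<Longrightarrow> \<bar>h z\<bar> \<le> C"
    and orth: "\<And>\<phi> K. \<phi> \<in> borel_measurable borel \<Longrightarrow> (\<And>s. \<bar>\<phi> s\<bar> \<le> K) \<Longrightarrow> (\<integral>z. \<phi> (T z) * h z \<partial>P) = 0"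
    and sq: "AE \<omega> in M. (\<Sum>i\<in>I. (W i (\<lambda>i\<in>I. T (Z i \<omega>)))\<^sup>2) \<le> V"
  shows "expectation (\<lambda>\<omega>. (\<Sum>i\<in>I. W i (\<lambda>i\<in>I. T (Z i \<omega>)) * h (Z i \<omega>))\<^sup>2) \<le> C\<^sup>2 * V"
    and "integrable M (\<lambda>\<omega>. (\<Sum>i\<in>I. W i (\<lambda>i\<in>I. T (Z i \<omega>)) * h (Z i \<omega>))\<^sup>2)"
proof -
  \<comment> \<open>The bound on \<open>h\<close> is given on \<open>space P\<close> only, so
    \<open>C >= 0\<close> needs a point there.\<close>
  obtain z0 where "z0 \<in> space P"
    using P.not_empty by auto
  then have C: "0 \<le> C"
    using h_bnd[of z0] by linarith
  define w where "w i \<omega> = W i (\<lambda>i\<in>I. T (Z i \<omega>))" for i \<omega>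
  have Zm [measurable]: "Z i \<in> measurable M P" if "i \<in> I" for i
    using that I by auto
  have [measurable]: "(\<lambda>\<omega>. \<lambda>i\<in>I. T (Z i \<omega>)) \<in> measurable M (PiM I (\<lambda>_. borel))"
    using I by (intro measurable_restrict) auto
  have wm [measurable]: "w i \<in> borel_measurable M" if "i \<in> I" for i
    unfolding w_def using that by measurable
  have hZ: "\<bar>h (Z i \<omega>)\<bar> \<le> C" if "i \<in> I" "\<omega> \<in> space M" for i \<omega>
    using h_bnd measurable_space[OF Zm] that by auto
  have int: "integrable M (\<lambda>\<omega>. w i \<omega> * w j \<omega> * (h (Z i \<omega>) * h (Z j \<omega>)))" if "i \<in> I" "j \<in> I" for i j
  proof (rule integrable_const_bound[of _ "B * B * (C * C)"])
    show "AE \<omega> in M. norm (w i \<omega> * w j \<omega> * (h (Z i \<omega>) * h (Z j \<omega>))) \<le> B * B * (C * C)"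
      using that hZ W_bnd C
      by (intro AE_I2) (auto simp: abs_mult w_def intro!: mult_mono order_trans[OF abs_ge_zero W_bnd])
  qed (use that in measurable)
  have cross: "expectation (\<lambda>\<omega>. w i \<omega> * w j \<omega> * (h (Z i \<omega>) * h (Z j \<omega>))) = 0"
    if ij: "i \<in> I" "j \<in> I" "i \<noteq> j" for i j
  proof -
    define G where "G z = W i (\<lambda>l\<in>I. T (z l)) * W j (\<lambda>l\<in>I. T (z l)) * (h (z i) * h (z j))" for z
    have [measurable]: "(\<lambda>z. \<lambda>l\<in>I. T (z l)) \<in> measurable (PiM I (\<lambda>_. P)) (PiM I (\<lambda>_. borel))"
      by (intro measurable_restrict) auto
    have "expectation (\<lambda>\<omega>. G (\<lambda>i\<in>I. Z i \<omega>)) = 0"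
    proof (rule expectation_eq_0_by_coordinate[where i = i])
      show "G \<in> borel_measurable (PiM I (\<lambda>_. P))"
        unfolding G_def using ij by measurable
      show "\<bar>G z\<bar> \<le> B * B * (C * C)" if "z \<in> space (PiM I (\<lambda>_. P))" for z
        using that ij h_bnd W_bnd C unfolding G_def abs_mult
        by (intro mult_mono) (auto simp: space_PiM intro!: order_trans[OF abs_ge_zero W_bnd])
      fix z assume z: "z \<in> space (PiM (I - {i}) (\<lambda>_. P))"
      \<comment> \<open>The cofactor of \<open>h\<close> at observation \<open>i\<close>, as a
        function of the score \<open>s\<close> of \<open>i\<close>. Both weights may involve
        \<open>s\<close>, while \<open>h (z j)\<close> is a constant since \<open>j\<close> differs
        from \<open>i\<close>.\<close>
      define \<phi> where "\<phi> s = W i (\<lambda>l\<in>I. if l = i then s else T (z l))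
          * W j (\<lambda>l\<in>I. if l = i then s else T (z l)) * h (z j)" for s
      have [measurable]: "(\<lambda>s. \<lambda>l\<in>I. if l = i then s else T (z l)) \<in> measurable borel (PiM I (\<lambda>_. borel))"
        by (intro measurable_restrict) auto
      have "\<phi> \<in> borel_measurable borel"
        unfolding \<phi>_def using ij by measurable
      moreover have "\<bar>\<phi> s\<bar> \<le> B * B * C" for s
        using z ij h_bnd W_bnd C unfolding \<phi>_def abs_mult
        by (intro mult_mono) (auto simp: space_PiM intro!: order_trans[OF abs_ge_zero W_bnd])
      ultimately have "(\<integral>y. \<phi> (T y) * h y \<partial>P) = 0"
        by (rule orth)
      moreover have "(\<lambda>l\<in>I. T ((z(i := y)) l)) = (\<lambda>l\<in>I. if l = i then T y else T (z l))" for y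
        by auto
      ultimately show "(\<integral>y. G (z(i := y)) \<partial>P) = 0"
        using ij by (simp add: G_def \<phi>_def mult_ac)
    qed (use I ij in auto)
    moreover have "G (\<lambda>i\<in>I. Z i \<omega>) = w i \<omega> * w j \<omega> * (h (Z i \<omega>) * h (Z j \<omega>))" for \<omega>
      using ij by (simp add: G_def w_def cong: restrict_cong)
    ultimately show ?thesis
      by simp
  qed
  have expand: "(\<Sum>i\<in>I. w i \<omega> * h (Z i \<omega>))\<^sup>2 = (\<Sum>i\<in>I. \<Sum>j\<in>I. w i \<omega> * w j \<omega> * (h (Z i \<omega>) * h (Z j \<omega>)))" for \<omega>
    by (simp add: power2_eq_square sum_product mult_ac)
  show "integrable M (\<lambda>\<omega>. (\<Sum>i\<in>I. W i (\<lambda>i\<in>I. T (Z i \<omega>)) * h (Z i \<omega>))\<^sup>2)"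
    unfolding w_def[symmetric] expand using int by (intro Bochner_Integration.integrable_sum)
  have "expectation (\<lambda>\<omega>. (\<Sum>i\<in>I. w i \<omega> * h (Z i \<omega>))\<^sup>2)
      = (\<Sum>i\<in>I. \<Sum>j\<in>I. expectation (\<lambda>\<omega>. w i \<omega> * w j \<omega> * (h (Z i \<omega>) * h (Z j \<omega>))))"
    unfolding expand using int
    by (subst Bochner_Integration.integral_sum; (intro sum.cong refl Bochner_Integration.integrable_sum)?)
       (auto intro!: Bochner_Integration.integral_sum)
  also have "\<dots> = (\<Sum>i\<in>I. \<Sum>j\<in>I. if j = i then expectation (\<lambda>\<omega>. (w i \<omega>)\<^sup>2 * (h (Z i \<omega>))\<^sup>2) else 0)"
    using cross by (intro sum.cong) (auto simp: power2_eq_square mult_ac)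
  also have "\<dots> = (\<Sum>i\<in>I. expectation (\<lambda>\<omega>. (w i \<omega>)\<^sup>2 * (h (Z i \<omega>))\<^sup>2))"
    using I by simp
  also have "\<dots> = expectation (\<lambda>\<omega>. \<Sum>i\<in>I. (w i \<omega>)\<^sup>2 * (h (Z i \<omega>))\<^sup>2)"
    using int by (subst Bochner_Integration.integral_sum) (auto simp: power2_eq_square mult_ac)
  also have "\<dots> \<le> expectation (\<lambda>\<omega>. C\<^sup>2 * V)"
  proof (rule integral_mono_AE)
    show "integrable M (\<lambda>\<omega>. \<Sum>i\<in>I. (w i \<omega>)\<^sup>2 * (h (Z i \<omega>))\<^sup>2)"
      using int by (intro Bochner_Integration.integrable_sum) (simp add: power2_eq_square mult_ac)
    have "AE \<omega> in M. \<omega> \<in> space M"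
      by auto
    with sq show "AE \<omega> in M. (\<Sum>i\<in>I. (w i \<omega>)\<^sup>2 * (h (Z i \<omega>))\<^sup>2) \<le> C\<^sup>2 * V"
    proof eventually_elim
      case (elim \<omega>)
      have "(\<Sum>i\<in>I. (w i \<omega>)\<^sup>2 * (h (Z i \<omega>))\<^sup>2) \<le> (\<Sum>i\<in>I. (w i \<omega>)\<^sup>2 * C\<^sup>2)"
        using hZ elim C by (intro sum_mono mult_left_mono) (auto simp: abs_le_square_iff[symmetric])
      also have "\<dots> = C\<^sup>2 * (\<Sum>i\<in>I. (w i \<omega>)\<^sup>2)"
        by (simp add: sum_distrib_left mult_ac)
      also have "\<dots> \<le> C\<^sup>2 * V"
        using elim by (intro mult_left_mono) (auto simp: w_def)
      finally show ?case .
    qed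
  qed auto
  also have "\<dots> = C\<^sup>2 * V"
    by (simp add: prob_space)
  finally show "expectation (\<lambda>\<omega>. (\<Sum>i\<in>I. W i (\<lambda>i\<in>I. T (Z i \<omega>)) * h (Z i \<omega>))\<^sup>2) \<le> C\<^sup>2 * V"
    by (simp add: w_def)
qed

lemma ranked_noise_in_events:
  fixes T h :: "'a \<Rightarrow> real" and v :: "nat \<Rightarrow> real"
  assumes T: "T \<in> borel_measurable P" and h: "h \<in> borel_measurable P"
  shows "{\<omega> \<in> space M. c < \<bar>\<Sum>i = 1..n. v (score_rank n (\<lambda>i. T (Z i \<omega>)) i) * h (Z i \<omega>)\<bar>} \<in> events"
proof -
  have t: "(\<lambda>\<omega>. \<lambda>i\<in>{1..n}. T (Z i \<omega>)) \<in> measurable M (PiM {1..n} (\<lambda>_. borel))"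
    using T by (intro measurable_restrict measurable_compose[OF measurable_Z]) auto
  have "(\<lambda>\<omega>. v (score_rank n (\<lambda>i. T (Z i \<omega>)) i)) \<in> borel_measurable M" if i: "i \<in> {1..n}" for i
  proof -
    have "score_rank n (\<lambda>i. T (Z i \<omega>)) i = score_rank n (\<lambda>i\<in>{1..n}. T (Z i \<omega>)) i" for \<omega>
      using score_rank_restrict[OF i] by simp
    then show ?thesis
      using measurable_compose[OF measurable_compose[OF t measurable_score_rank[OF i]], of v borel] by simp
  qed
  moreover have "(\<lambda>\<omega>. h (Z i \<omega>)) \<in> borel_measurable M" if "i \<in> {1..n}" for i
    using h that by (intro measurable_compose[OF measurable_Z]) auto
  ultimately have "(\<lambda>\<omega>. \<Sum>i = 1..n. v (score_rank n (\<lambda>i. T (Z i \<omega>)) i) * h (Z i \<omega>)) \<in> borel_measurable M"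
    by (intro borel_measurable_sum borel_measurable_times)
  then show ?thesis
    by measurable
qed

text \<open>Chebyshev's inequality. With \<open>W\<close> the sum of the first \<open>k\<close>
  discounts, the second moment is at most \<open>C^2 * D 1 * W\<close>, linear in \<open>W\<close>;
  dividing by \<open>(d * W)^2\<close> leaves a bound of order \<open>1 / W\<close>.\<close>

lemma ranked_noise_tail:
  fixes T h :: "'a \<Rightarrow> real"
  assumes T [measurable]: "T \<in> borel_measurable P" and h [measurable]: "h \<in> borel_measurable P"
    and atomless: "\<And>t. measure P {z \<in> space P. T z = t} = 0"
    and h_bnd: "\<And>z. z \<in> space P \<Longrightarrow> \<bar>h z\<bar> \<le> C"
    and orth: "\<And>\<phi> K. \<phi> \<in> borel_measurable borel \<Longrightarrow> (\<And>s. \<bar>\<phi> s\<bar> \<le> K) \<Longrightarrow> (\<integral>z. \<phi> (T z) * h z \<partial>P) = 0"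
    and D: "\<And>r. 1 \<le> r \<Longrightarrow> 0 \<le> D r" and D_le: "\<And>r. 1 \<le> r \<Longrightarrow> D r \<le> D 1"
    and pos: "0 < (\<Sum>r = 1..k. D r)" and kn: "k \<le> n" and d: "0 < d"
  shows "prob {\<omega> \<in> space M. d * (\<Sum>r = 1..k. D r)
      < \<bar>\<Sum>i = 1..n. cutoff k D (score_rank n (\<lambda>i. T (Z i \<omega>)) i) * h (Z i \<omega>)\<bar>}
    \<le> C\<^sup>2 * D 1 / d\<^sup>2 / (\<Sum>r = 1..k. D r)"
proof -
  define W where "W = (\<Sum>r = 1..k. D r)"
  define I where "I = {1..n}"
  define w where "w i t = cutoff k D (score_rank n t i)" for i t
  define U where "U \<omega> = (\<Sum>i\<in>I. w i (\<lambda>i\<in>I. T (Z i \<omega>)) * h (Z i \<omega>))" for \<omega>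
  have w_restrict: "w i (\<lambda>i\<in>I. t i) = w i t" if "i \<in> I" for t i
    using that by (simp only: w_def I_def score_rank_restrict)
  \<comment> \<open>A rank is a successor, so \<open>D\<close> is evaluated at positive arguments
    only, where it lies between 0 and \<open>D 1\<close>.\<close>
  have bounds: "0 \<le> w i t" "w i t \<le> D 1" for i t
    using D D_le[of "score_rank n t i"] D[of 1] by (auto simp: w_def cutoff_def score_rank_def)
  \<comment> \<open>Without ties each rank occurs once, and the squared weights add up to
    \<open>D 1 ^ 2 + ... + D k ^ 2\<close>, at most \<open>D 1 * W\<close>. Tied items could repeat
    a large discount, so the bound is claimed almost surely.\<close>
  have sq: "AE \<omega> in M. (\<Sum>i\<in>I. (w i (\<lambda>i\<in>I. T (Z i \<omega>)))\<^sup>2) \<le> D 1 * W"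
    using AE_inj_on_scores[OF T atomless, of n]
  proof eventually_elim
    case (elim \<omega>)
    define t where "t i = T (Z i \<omega>)" for i
    have "(\<Sum>i\<in>I. (w i (\<lambda>i\<in>I. t i))\<^sup>2) = (\<Sum>i = 1..n. (cutoff k D (score_rank n t i))\<^sup>2)"
      unfolding I_def[symmetric] by (intro sum.cong refl) (simp only: w_restrict, simp only: w_def)
    also have "\<dots> = (\<Sum>r = 1..n. (cutoff k D r)\<^sup>2)"
      using elim unfolding t_def by (intro sum.reindex_bij_betw bij_betw_score_rank)
    also have "\<dots> = (\<Sum>r = 1..k. (D r)\<^sup>2)"
      using sum_cutoff[OF kn, of "\<lambda>x. x\<^sup>2"] by simp
    also have "\<dots> \<le> (\<Sum>r = 1..k. D 1 * D r)"
      using D D_le by (intro sum_mono) (simp add: power2_eq_square mult_right_mono)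
    finally show ?case
      by (simp add: t_def W_def sum_distrib_left)
  qed
  have w_meas: "w i \<in> borel_measurable (PiM I (\<lambda>_. borel))" if "i \<in> I" for i
    unfolding w_def by (rule measurable_compose[OF measurable_score_rank[of i n, folded I_def]]) (use that in simp_all)
  have I: "finite I" "I \<subseteq> {1..}"
    by (auto simp: I_def)
  have w_bnd: "\<bar>w i t\<bar> \<le> D 1" for i t
    using bounds[of i t] by simp
  have moment: "expectation (\<lambda>\<omega>. (U \<omega>)\<^sup>2) \<le> C\<^sup>2 * (D 1 * W)"
    unfolding U_def by (rule second_moment_weighted_noise(1)[OF I T h w_meas w_bnd h_bnd _ sq]) (assumption | fact orth)+
  have int: "integrable M (\<lambda>\<omega>. (U \<omega>)\<^sup>2)"
    unfolding U_def by (rule second_moment_weighted_noise(2)[OF I T h w_meas w_bnd h_bnd _ sq]) (assumption | fact orth)+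
  have U_eq: "U \<omega> = (\<Sum>i = 1..n. cutoff k D (score_rank n (\<lambda>i. T (Z i \<omega>)) i) * h (Z i \<omega>))" for \<omega>
    unfolding U_def I_def[symmetric] by (intro sum.cong refl) (simp only: w_restrict, simp only: w_def)
  have "prob {\<omega> \<in> space M. d * W < \<bar>U \<omega>\<bar>} \<le> prob {\<omega> \<in> space M. (d * W)\<^sup>2 \<le> (U \<omega>)\<^sup>2}"
  proof (intro finite_measure_mono)
    show "{\<omega> \<in> space M. d * W < \<bar>U \<omega>\<bar>} \<subseteq> {\<omega> \<in> space M. (d * W)\<^sup>2 \<le> (U \<omega>)\<^sup>2}"
      using d pos by (auto simp: W_def abs_le_square_iff[symmetric])
    show "{\<omega> \<in> space M. (d * W)\<^sup>2 \<le> (U \<omega>)\<^sup>2} \<in> events"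
      using borel_measurable_integrable[OF int] by measurable
  qed
  also have "\<dots> \<le> expectation (\<lambda>\<omega>. (U \<omega>)\<^sup>2) / (d * W)\<^sup>2"
    using d pos int by (intro integral_Markov_inequality_measure[of _ _ "{}"]) (auto simp: W_def)
  also have "\<dots> \<le> C\<^sup>2 * (D 1 * W) / (d * W)\<^sup>2"
    by (intro divide_right_mono moment) auto
  also have "\<dots> = C\<^sup>2 * D 1 / d\<^sup>2 / W"
    using d pos by (simp add: W_def[symmetric] field_simps power2_eq_square)
  finally show ?thesis
    by (simp only: U_eq W_def)
qed

end

subsection \<open>The canonical score\<close>

text \<open>Without atoms the distribution function is continuous; its limits 0 and 1 and the
  intermediate value theorem do the rest.\<close>

lemma (in real_distribution) cdf_attains:
  assumes atomless: "\<And>t. measure M {t} = 0" and c: "0 < c" "c < 1"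
  shows "\<exists>u. cdf M u = c"
proof -
  have "\<forall>\<^sub>F u in at_bot. cdf M u < c" "\<forall>\<^sub>F u in at_top. c < cdf M u"
    using order_tendstoD(2)[OF cdf_lim_at_bot c(1)] order_tendstoD(1)[OF cdf_lim_at_top_prob c(2)]
    by auto
  then obtain a b where ab: "cdf M a < c" "c < cdf M b"
    by (auto simp: eventually_at_bot_linorder eventually_at_top_linorder)
  then have "a \<le> b"
    using cdf_nondecreasing[of b a] by linarith
  moreover have "isCont (cdf M) u" for u
    using atomless by (simp add: isCont_cdf)
  ultimately show ?thesis
    using IVT[of "cdf M" a c b] ab by auto
qed

text \<open>A level set of the distribution function is closed; its part in \<open>{- n..n}\<close> has a least and a
  largest element, and the distribution function does not increase between the two.\<close>

lemma (in real_distribution) prob_cdf_eq: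
  assumes atomless: "\<And>t. measure M {t} = 0"
  shows "measure M {u. cdf M u = t} = 0"
proof -
  define E where "E n = {u. cdf M u = t} \<inter> {- real n..real n}" for n
  have "continuous_on UNIV (cdf M)"
    using atomless by (intro continuous_at_imp_continuous_on) (simp add: isCont_cdf)
  then have closed: "closed {u. cdf M u = t}"
    by (intro closed_Collect_eq) auto
  have null: "E n \<in> null_sets M" for n
  proof (cases "E n = {}")
    case False
    have "compact (E n)"
      unfolding E_def using closed by (intro closed_Int_compact) auto
    then obtain a b where a: "a \<in> E n" "\<forall>u\<in>E n. a \<le> u" and b: "b \<in> E n" "\<forall>u\<in>E n. u \<le> b"
      using False compact_attains_inf compact_attains_sup by metis
    have "measure M {a<..b} = cdf M b - cdf M a" if "a < b"
      using cdf_diff_eq[OF that] by simp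
    then have "measure M {a<..b} = 0"
      using a(1) b(1) by (cases "a < b") (auto simp: E_def)
    \<comment> \<open>Differences of the distribution function measure half-open intervals; the
      missing left endpoint is added as a further null set.\<close>
    then have "{a<..b} \<in> null_sets M" "{a} \<in> null_sets M"
      using atomless by (auto intro!: null_setsI simp: emeasure_eq_measure)
    then have "{a} \<union> {a<..b} \<in> null_sets M"
      by (intro null_sets.Un)
    moreover have "E n \<subseteq> {a} \<union> {a<..b}"
      using a(2) b(2) by force
    moreover have "E n \<in> sets M"
      unfolding E_def using closed by auto
    ultimately show ?thesis
      using null_sets_subset by blast
  qed auto
  have "u \<in> (\<Union>n. {- real n..real n})" for u :: real
    using real_arch_simple[of "\<bar>u\<bar>"] by (auto simp: abs_le_iff) (meson neg_le_iff_le minus_le_iff)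
  then have "{u. cdf M u = t} = (\<Union>n. E n)"
    unfolding E_def by blast
  then have "{u. cdf M u = t} \<in> null_sets M"
    using null by auto
  then show ?thesis
    by (simp add: measure_eq_0_null_sets)
qed

text \<open>Choose \<open>u\<close> where the distribution function equals a value strictly between
  \<open>c\<close> and 1. All points right of \<open>u\<close> belong to the set, and their mass
  \<open>1 - cdf M u\<close> is positive.\<close>

lemma (in real_distribution) prob_cdf_gt_pos:
  assumes atomless: "\<And>t. measure M {t} = 0" and c: "c < 1"
  shows "0 < measure M {u. c < cdf M u}"
proof -
  \<comment> \<open>The midpoint of \<open>max c 0\<close> and 1; the maximum keeps it in the open
    unit interval even for negative \<open>c\<close>.\<close>
  have "0 < (max c 0 + 1) / 2" "(max c 0 + 1) / 2 < 1"
    using c by (auto simp: max_def)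
  then obtain u where u: "cdf M u = (max c 0 + 1) / 2"
    using cdf_attains[OF atomless] by blast
  have [measurable]: "cdf M \<in> borel_measurable borel"
    by (intro borel_measurable_mono monoI cdf_nondecreasing)
  have "0 < 1 - cdf M u"
    using u c by (auto simp: max_def split: if_splits)
  also have "\<dots> = measure M {u<..}"
  proof -
    have "{u<..} = space M - {..u}"
      by auto
    then show ?thesis
      using prob_compl[of "{..u}"] by (simp add: cdf_def2)
  qed
  also have "\<dots> \<le> measure M {v. c < cdf M v}"
  proof (intro finite_measure_mono subsetI)
    fix v assume "v \<in> {u<..}"
    then show "v \<in> {v. c < cdf M v}"
      using cdf_nondecreasing[of u v] u c by (auto simp: max_def split: if_splits)
  qed auto
  finally show ?thesis .
qed

text \<open>This reduces questions about the canonical score to the distribution function of a law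
  on the real line.\<close>

lemma canonical_eq_cdf:
  assumes f: "(\<lambda>z. f (fst z)) \<in> borel_measurable P"
  shows "canonical P f x = cdf (distr P borel (\<lambda>z. f (fst z))) (f x)"
  using f by (simp add: canonical_def cdf_def2 measure_distr vimage_def Int_def conj_commute)

text \<open>These facts let the canonical score replace \<open>f\<close>. An ordering by
  \<open>f\<close> is also one by the canonical score. The latter is constant where the distribution
  function of \<open>f\<close> is flat, which creates new ties, but for atomless \<open>f\<close>
  each of its level sets is still null.\<close>

lemma
  fixes P :: "('x \<times> real) measure" and f :: "'x \<Rightarrow> real"
  assumes P: "prob_space P" and f: "(\<lambda>z. f (fst z)) \<in> borel_measurable P"
  shows canonical_in_01: "canonical P f x \<in> {0..1}"
    and canonical_mono: "f x \<le> f y \<Longrightarrow> canonical P f x \<le> canonical P f y"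
    and measurable_canonical: "(\<lambda>z. canonical P f (fst z)) \<in> borel_measurable P"
    and canonical_atomless: "(\<And>t. measure P {z \<in> space P. f (fst z) = t} = 0) \<Longrightarrow>
      measure P {z \<in> space P. canonical P f (fst z) = t} = 0"
    and canonical_gt_pos: "(\<And>t. measure P {z \<in> space P. f (fst z) = t} = 0) \<Longrightarrow> c < 1 \<Longrightarrow>
      0 < measure P {z \<in> space P. c < canonical P f (fst z)}"
proof -
  interpret prob_space P
    by fact
  define \<mu> where "\<mu> = distr P borel (\<lambda>z. f (fst z))"
  interpret \<mu>: real_distribution \<mu>
    unfolding \<mu>_def using f by (rule real_distribution_distr)
  have eq: "canonical P f x = cdf \<mu> (f x)" for x
    unfolding \<mu>_def by (rule canonical_eq_cdf[OF f])
  have cdf_meas [measurable]: "cdf \<mu> \<in> borel_measurable borel"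
    by (intro borel_measurable_mono monoI \<mu>.cdf_nondecreasing)
  show "canonical P f x \<in> {0..1}"
    by (simp add: canonical_def)
  show "f x \<le> f y \<Longrightarrow> canonical P f x \<le> canonical P f y"
    unfolding eq by (rule \<mu>.cdf_nondecreasing)
  show "(\<lambda>z. canonical P f (fst z)) \<in> borel_measurable P"
    unfolding eq using f by measurable
  have transfer: "measure \<mu> {u. Q (cdf \<mu> u)} = measure P {z \<in> space P. Q (canonical P f (fst z))}"
    if "{u. Q (cdf \<mu> u)} \<in> sets borel" for Q
    using that f unfolding eq by (simp add: \<mu>_def measure_distr vimage_def Int_def conj_commute)
  have \<mu>_atomless: "measure \<mu> {t} = 0" if "\<And>t. measure P {z \<in> space P. f (fst z) = t} = 0" for t
    using that[of t] f by (simp add: \<mu>_def measure_distr vimage_def Int_def conj_commute)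
  show "measure P {z \<in> space P. canonical P f (fst z) = t} = 0"
    if "\<And>t. measure P {z \<in> space P. f (fst z) = t} = 0"
    using \<mu>.prob_cdf_eq[OF \<mu>_atomless[OF that], of t] transfer[of "\<lambda>s. s = t"] by simp
  show "0 < measure P {z \<in> space P. c < canonical P f (fst z)}"
    if "\<And>t. measure P {z \<in> space P. f (fst z) = t} = 0" "c < 1"
    using \<mu>.prob_cdf_gt_pos[OF \<mu>_atomless[OF that(1)] that(2)] transfer[of "\<lambda>s. c < s"] by simp
qed

text \<open>A function of the score is measurable for the sigma-algebra which the score generates,
  so under the integral the label may be replaced by its conditional expectation. Scores lie in
  \<open>{0..1}\<close>, where \<open>\<zeta>\<close> agrees with \<open>\<eta>\<close>;
  \<open>\<zeta>\<close> is moreover measurable and bounded on the whole line.\<close>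

lemma cond_label_prob_orthogonal:
  fixes P :: "('x \<times> real) measure" and f :: "'x \<Rightarrow> real"
  assumes P: "prob_space P" and f: "(\<lambda>z. f (fst z)) \<in> borel_measurable P"
    and snd [measurable]: "snd \<in> borel_measurable P"
    and labels: "\<And>z. z \<in> space P \<Longrightarrow> snd z \<in> {0, 1}"
    and \<eta>: "cond_label_prob P f \<eta>"
    and \<zeta> [measurable]: "\<zeta> \<in> borel_measurable borel"
    and \<zeta>_eq: "\<And>s. s \<in> {0..1} \<Longrightarrow> \<zeta> s = \<eta> s"
    and \<zeta>_bnd: "\<And>s. \<bar>\<zeta> s\<bar> \<le> C"
    and \<phi> [measurable]: "\<phi> \<in> borel_measurable borel" and \<phi>_bnd: "\<And>s. \<bar>\<phi> s\<bar> \<le> K"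
  shows "(\<integral>z. \<phi> (canonical P f (fst z)) * (snd z - \<zeta> (canonical P f (fst z))) \<partial>P) = 0"
proof -
  interpret prob_space P
    by fact
  define T where "T z = canonical P f (fst z)" for z :: "'x \<times> real"
  define A where "A = {z \<in> space P. snd z = 1}"
  define F where "F = vimage_algebra (space P) T borel"
  have T [measurable]: "T \<in> borel_measurable P"
    unfolding T_def by (rule measurable_canonical[OF P f])
  have T_F: "T \<in> borel_measurable F"
    unfolding F_def by (rule measurable_vimage_algebra1) auto
  have "finite_measure_subalgebra P F"
  proof unfold_locales
    show "subalgebra P F"
      unfolding subalgebra_def F_def by (intro conjI sets_image_in_sets T) auto
  qed
  then interpret F: finite_measure_subalgebra P F .
  have [measurable]: "A \<in> sets P"
    unfolding A_def by measurable
  have int1: "integrable P (\<lambda>z. \<phi> (T z) * indicat_real A z)"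
    using \<phi>_bnd by (intro integrable_const_bound[of _ K] AE_I2)
      (auto simp: abs_mult indicator_def order_trans[OF abs_ge_zero \<phi>_bnd])
  have int2: "integrable P (\<lambda>z. \<phi> (T z) * \<zeta> (T z))"
    using \<phi>_bnd \<zeta>_bnd by (intro integrable_const_bound[of _ "K * C"] AE_I2)
      (auto simp: abs_mult intro!: mult_mono order_trans[OF abs_ge_zero \<phi>_bnd])
  \<comment> \<open>A label in \<open>{0, 1}\<close> is the indicator of the event that it equals 1,
    which is what \<open>cond_label_prob\<close> conditions.\<close>
  have "(\<integral>z. \<phi> (T z) * snd z \<partial>P) = (\<integral>z. \<phi> (T z) * indicat_real A z \<partial>P)"
    using labels by (intro Bochner_Integration.integral_cong) (auto simp: A_def indicator_def)
  also have "\<dots> = (\<integral>z. \<phi> (T z) * real_cond_exp P F (indicator A) z \<partial>P)"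
    using measurable_compose[OF T_F \<phi>] by (intro F.real_cond_exp_intg(2)[symmetric] int1) auto
  also have "\<dots> = (\<integral>z. \<phi> (T z) * \<zeta> (T z) \<partial>P)"
  proof (intro integral_cong_AE)
    have \<zeta>_T: "\<zeta> (T z) = \<eta> (T z)" for z
      unfolding T_def by (intro \<zeta>_eq canonical_in_01[OF P f])
    have "AE z in P. real_cond_exp P F (indicator A) z = \<eta> (T z)"
      using \<eta> by (simp add: cond_label_prob_def T_def[abs_def] F_def A_def)
    then show "AE z in P. \<phi> (T z) * real_cond_exp P F (indicator A) z = \<phi> (T z) * \<zeta> (T z)"
      by eventually_elim (simp add: \<zeta>_T)
  qed auto
  finally have eq: "(\<integral>z. \<phi> (T z) * snd z \<partial>P) = (\<integral>z. \<phi> (T z) * \<zeta> (T z) \<partial>P)" .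
  have int3: "integrable P (\<lambda>z. \<phi> (T z) * snd z)"
    using int1 by (rule Bochner_Integration.integrable_cong[THEN iffD1, rotated -1])
      (use labels in \<open>auto simp: A_def indicator_def\<close>)
  have "(\<integral>z. \<phi> (T z) * (snd z - \<zeta> (T z)) \<partial>P) = (\<integral>z. \<phi> (T z) * snd z - \<phi> (T z) * \<zeta> (T z) \<partial>P)"
    by (simp add: right_diff_distrib)
  also have "\<dots> = 0"
    using int2 int3 eq by simp
  finally show ?thesis
    by (simp add: T_def)
qed

subsection \<open>Convergence of the NDCG\<close>

lemma measurable_NDCG:
  fixes X :: "'x measure" and P :: "('x \<times> real) measure" and Z :: "nat \<Rightarrow> 'w \<Rightarrow> 'x \<times> real"
  assumes sets_P: "sets P = sets (X \<Otimes>\<^sub>M count_space {0, 1})"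
    and Z: "\<And>i. 1 \<le> i \<Longrightarrow> Z i \<in> measurable M P"
    and \<sigma>: "score_ordering X f \<sigma>"
  shows "(\<lambda>\<omega>. NDCG D \<sigma> n (\<lambda>i. Z i \<omega>)) \<in> borel_measurable M"
proof -
  have Z' [measurable]: "Z i \<in> measurable M (X \<Otimes>\<^sub>M count_space {0, 1})" if "1 \<le> i" for i
    using Z[OF that] by (simp add: measurable_cong_sets[OF refl sets_P])
  have y [measurable]: "(\<lambda>\<omega>. snd (Z i \<omega>)) \<in> borel_measurable M" if "1 \<le> i" for i
    using that by (intro measurable_compose[OF measurable_snd'[OF Z']]) auto
  define x where "x \<omega> = (\<lambda>i\<in>{1..n}. fst (Z i \<omega>))" for \<omega>
  have x [measurable]: "x \<in> measurable M (PiM {1..n} (\<lambda>_. X))"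
    unfolding x_def by (intro measurable_restrict) auto
  have label: "(\<lambda>\<omega>. ranked_label \<sigma> n (\<lambda>i. Z i \<omega>) r) \<in> borel_measurable M" if r: "r \<in> {1..n}" for r
  proof -
    have "(\<lambda>x. \<sigma> n x r) \<in> measurable (PiM {1..n} (\<lambda>_. X)) (count_space UNIV)"
      using \<sigma> r by (auto simp: score_ordering_def)
    then have [measurable]: "(\<lambda>\<omega>. \<sigma> n (x \<omega>) r) \<in> measurable M (count_space UNIV)"
      by (rule measurable_compose[OF x])
    \<comment> \<open>The label is read at a random index. Splitting over the finitely many values
      of the index leaves only measurable pieces.\<close>
    have eq: "ranked_label \<sigma> n (\<lambda>i. Z i \<omega>) r = (\<Sum>i = 1..n. if \<sigma> n (x \<omega>) r = i then snd (Z i \<omega>) else 0)"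
      if "\<omega> \<in> space M" for \<omega>
    proof -
      have "\<sigma> n (x \<omega>) permutes {1..n}"
        using \<sigma> measurable_space[OF x that] by (auto simp: score_ordering_def)
      then have "\<sigma> n (x \<omega>) r \<in> {1..n}"
        using r by (simp only: permutes_in_image)
      then show ?thesis
        by (simp add: ranked_label_def x_def)
    qed
    have "(\<lambda>\<omega>. \<Sum>i = 1..n. if \<sigma> n (x \<omega>) r = i then snd (Z i \<omega>) else 0) \<in> borel_measurable M"
      by (intro borel_measurable_sum measurable_If) auto
    then show ?thesis
      by (subst measurable_cong[OF eq])
  qed
  have DCG: "(\<lambda>\<omega>. DCG D \<sigma> n (\<lambda>i. Z i \<omega>)) \<in> borel_measurable M"
    unfolding DCG_def using label by (intro borel_measurable_sum borel_measurable_times) auto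
  have "(\<lambda>\<omega>. Max ((\<lambda>\<pi>. \<Sum>r = 1..n. snd (Z (\<pi> r) \<omega>) * D r) ` {\<pi>. \<pi> permutes {1..n}})) \<in> borel_measurable M"
  proof (intro borel_measurable_Max borel_measurable_sum borel_measurable_times y)
    show "1 \<le> \<pi> r" if "\<pi> \<in> {\<pi>. \<pi> permutes {1..n}}" "r \<in> {1..n}" for \<pi> r
      using that permutes_in_image[of \<pi> "{1..n}" r] by auto
  qed (auto simp: finite_permutations)
  then have "(\<lambda>\<omega>. IDCG D n (\<lambda>i. Z i \<omega>)) \<in> borel_measurable M"
    unfolding IDCG_def image_Collect .
  with DCG show ?thesis
    unfolding NDCG_def by measurable
qed

text \<open>The deterministic core, for one fixed sample. Relative to \<open>l * W\<close>, the DCG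
  splits into the noise and a bias. Only the first \<open>k\<close> ranks carry weight, and their
  items score above \<open>c\<close>, so the bias is at most \<open>e * W\<close>. Dividing by
  \<open>W\<close>, which is the IDCG, gives \<open>d + e\<close>.\<close>

lemma NDCG_cutoff_close:
  fixes t :: "nat \<Rightarrow> real"
  assumes \<sigma>: "score_ordering X f \<sigma>"
    and X: "\<And>i. i \<in> {1..n} \<Longrightarrow> fst (z i) \<in> space X"
    and labels: "\<And>i. i \<in> {1..n} \<Longrightarrow> snd (z i) \<in> {0, 1}"
    and D: "\<And>r. 1 \<le> r \<Longrightarrow> 0 \<le> D r" and pos: "0 < (\<Sum>r = 1..k. D r)"
    and mono: "\<And>i j. i \<in> {1..n} \<Longrightarrow> j \<in> {1..n} \<Longrightarrow> f (fst (z i)) \<le> f (fst (z j)) \<Longrightarrow> t i \<le> t j"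
    and inj: "inj_on t {1..n}"
    and ones: "k \<le> card {i \<in> {1..n}. snd (z i) = 1}"
    and top: "k \<le> card {i \<in> {1..n}. c < t i}"
    and near: "\<And>i. i \<in> {1..n} \<Longrightarrow> c < t i \<Longrightarrow> \<bar>\<zeta> (t i) - l\<bar> \<le> e"
    and noise: "\<bar>\<Sum>i = 1..n. cutoff k D (score_rank n t i) * (snd (z i) - \<zeta> (t i))\<bar> \<le> d * (\<Sum>r = 1..k. D r)"
  shows "\<bar>NDCG (cutoff k D) \<sigma> n z - l\<bar> \<le> d + e"
proof -
  define w where "w i = cutoff k D (score_rank n t i)" for i
  define W where "W = (\<Sum>r = 1..k. D r)"
  define x where "x = (\<lambda>i\<in>{1..n}. fst (z i))"
  have "card {i \<in> {1..n}. snd (z i) = 1} \<le> card {1..n}"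
    by (intro card_mono) auto
  with ones have kn: "k \<le> n"
    by simp
  have "x \<in> space (PiM {1..n} (\<lambda>_. X))"
    using X by (auto simp: x_def space_PiM)
  with \<sigma> have \<pi>: "\<sigma> n x permutes {1..n}"
    and sorted: "\<And>r s. r \<in> {1..n} \<Longrightarrow> s \<in> {1..n} \<Longrightarrow> r \<le> s \<Longrightarrow> f (x (\<sigma> n x s)) \<le> f (x (\<sigma> n x r))"
    by (auto simp: score_ordering_def)
  have \<pi>_in: "\<sigma> n x r \<in> {1..n}" if "r \<in> {1..n}" for r
    using permutes_in_image[OF \<pi>] that by blast
  \<comment> \<open>The rule orders by \<open>f\<close>, whereas ranks are taken with respect to
    \<open>t\<close>; monotonicity of \<open>t\<close> in \<open>f\<close> reconciles them.\<close>
  have t_sorted: "t (\<sigma> n x s) \<le> t (\<sigma> n x r)" if "r \<in> {1..n}" "s \<in> {1..n}" "r \<le> s" for r s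
    using that sorted[of r s] \<pi>_in[of r] \<pi>_in[of s] by (intro mono \<pi>_in) (simp_all add: x_def)
  note rank = sum_sorting_eq_sum_score_rank[OF \<pi> inj t_sorted]
  have "DCG (cutoff k D) \<sigma> n z = (\<Sum>r = 1..n. snd (z (\<sigma> n x r)) * cutoff k D r)"
    by (simp only: DCG_def ranked_label_def x_def)
  also have "\<dots> = (\<Sum>i = 1..n. snd (z i) * cutoff k D (score_rank n t i))"
    by (rule rank)
  finally have DCG: "DCG (cutoff k D) \<sigma> n z = (\<Sum>i = 1..n. w i * snd (z i))"
    by (simp add: w_def mult.commute)
  have W: "(\<Sum>i = 1..n. w i) = W"
    using rank[of "\<lambda>i r. cutoff k D r"] sum_cutoff[OF kn, of "\<lambda>x. x" D] by (simp add: w_def W_def)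
  have w_nonneg: "0 \<le> w i" for i
    using D by (simp add: w_def cutoff_def score_rank_def)
  have "\<bar>\<Sum>i = 1..n. w i * (\<zeta> (t i) - l)\<bar> \<le> (\<Sum>i = 1..n. w i * e)"
  proof (intro order_trans[OF sum_abs] sum_mono)
    fix i assume i: "i \<in> {1..n}"
    show "\<bar>w i * (\<zeta> (t i) - l)\<bar> \<le> w i * e"
    proof (cases "score_rank n t i \<le> k")
      case True
      then show ?thesis
        using near[OF i score_gt_of_score_rank_le[OF top True]] w_nonneg[of i]
        by (simp add: abs_mult mult_left_mono)
    qed (simp add: w_def cutoff_def)
  qed
  also have "\<dots> = e * W"
    by (simp add: W[symmetric] sum_distrib_left mult.commute)
  finally have bias: "\<bar>\<Sum>i = 1..n. w i * (\<zeta> (t i) - l)\<bar> \<le> e * W" .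
  have "DCG (cutoff k D) \<sigma> n z - l * W
      = (\<Sum>i = 1..n. w i * (snd (z i) - \<zeta> (t i))) + (\<Sum>i = 1..n. w i * (\<zeta> (t i) - l))"
    unfolding DCG W[symmetric] sum_distrib_left sum.distrib[symmetric] sum_subtractf[symmetric]
    by (intro sum.cong) (auto simp: algebra_simps)
  with bias noise have "\<bar>DCG (cutoff k D) \<sigma> n z - l * W\<bar> \<le> (d + e) * W"
    unfolding w_def[symmetric] W_def[symmetric] distrib_right by linarith
  moreover have "IDCG (cutoff k D) n z = W"
    unfolding W_def by (rule IDCG_cutoff[OF labels ones D])
  then have "NDCG (cutoff k D) \<sigma> n z - l = (DCG (cutoff k D) \<sigma> n z - l * W) / W"
    using pos by (simp add: NDCG_def W_def diff_divide_distrib)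
  ultimately show ?thesis
    using pos unfolding W_def[symmetric] by (simp add: abs_divide pos_divide_le_eq)
qed

theorem theorem7:
  fixes X :: "'x measure" and P :: "('x \<times> real) measure" and M :: "'w measure"
    and Z :: "nat \<Rightarrow> 'w \<Rightarrow> 'x \<times> real"
    and D :: "nat \<Rightarrow> real" and k :: "nat \<Rightarrow> nat"
    and f :: "'x \<Rightarrow> real" and \<sigma> :: "nat \<Rightarrow> (nat \<Rightarrow> 'x) \<Rightarrow> nat \<Rightarrow> nat"
    and \<eta> :: "real \<Rightarrow> real"
  assumes "prob_space P" and "sets P = sets (X \<Otimes>\<^sub>M count_space {0, 1})"
    and "measure P {z \<in> space P. snd z = 1} > 0"
    and "prob_space M"
    and "prob_space.indep_vars M (\<lambda>_. P) Z {1..}"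
    and "\<And>i. i \<ge> 1 \<Longrightarrow> distr M P (Z i) = P"
    and "\<And>r. r \<ge> 1 \<Longrightarrow> D r \<ge> 0"
    and "\<And>r s. 1 \<le> r \<Longrightarrow> r \<le> s \<Longrightarrow> D s \<le> D r"
    and "filterlim (\<lambda>m. \<Sum>r = 1..m. D r) at_top sequentially"
    and "(\<lambda>n. real (k n)) \<in> o(\<lambda>n. real n)"
    and "filterlim k at_top sequentially"
    and "f \<in> borel_measurable X"
    and "score_ordering X f \<sigma>"
    and "\<And>t. measure P {z \<in> space P. f (fst z) = t} = 0"
    and "cond_label_prob P f \<eta>"
    and "continuous_on {0..1} \<eta>"
  shows "tendsto_in_prob M (\<lambda>n \<omega>. NDCG (cutoff (k n) D) \<sigma> n (\<lambda>i. Z i \<omega>)) (\<eta> 1)"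
proof -
  note sets_P = assms(2) and D_nonneg = assms(7) and D_mono = assms(8) and k_small = assms(10)
    and \<sigma> = assms(13) and f_atomless = assms(14) and \<eta>_cond = assms(15) and \<eta>_cont = assms(16)
  interpret iid_sample M P Z
    by (intro iid_sample.intro iid_sample_axioms.intro assms)
  have space_P: "space P = space X \<times> {0, 1}"
    using sets_eq_imp_space_eq[OF sets_P] by (simp add: space_pair_measure)
  have "fst \<in> measurable P X"
    using measurable_fst by (simp add: measurable_cong_sets[OF sets_P refl])
  then have f: "(\<lambda>z. f (fst z)) \<in> borel_measurable P"
    by (rule measurable_compose) fact
  have "snd \<in> measurable P (count_space {0, 1})"
    using measurable_snd by (simp add: measurable_cong_sets[OF sets_P refl])
  then have snd: "snd \<in> borel_measurable P"
    by (rule measurable_compose) simp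
  have labels: "snd z \<in> {0, 1}" if "z \<in> space P" for z
    using that by (auto simp: space_P)
  have NDCG_meas [measurable]: "(\<lambda>\<omega>. NDCG (cutoff (k n) D) \<sigma> n (\<lambda>i. Z i \<omega>)) \<in> borel_measurable M" for n
    by (rule measurable_NDCG[OF sets_P measurable_Z \<sigma>])

  define T where "T z = canonical P f (fst z)" for z :: "'x \<times> real"
  have T: "T \<in> borel_measurable P"
    unfolding T_def by (rule measurable_canonical[OF assms(1) f])
  have T_01: "T z \<in> {0..1}" for z
    unfolding T_def by (rule canonical_in_01[OF assms(1) f])
  have T_atomless: "measure P {z \<in> space P. T z = t} = 0" for t
    unfolding T_def by (rule canonical_atomless[OF assms(1) f f_atomless])

  \<comment> \<open>Clamping the argument extends \<open>\<eta>\<close> continuously from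
    \<open>{0..1}\<close> to the line, with the same range. This provides Borel measurability and a
    global bound without changing values at canonical scores.\<close>
  define \<zeta> where "\<zeta> s = \<eta> (max 0 (min 1 s))" for s
  have \<zeta>_cont: "continuous_on UNIV \<zeta>"
    unfolding \<zeta>_def by (intro continuous_on_compose2[OF \<eta>_cont] continuous_intros) auto
  then have \<zeta>: "\<zeta> \<in> borel_measurable borel"
    by (rule borel_measurable_continuous_onI)
  have \<zeta>_eq: "\<zeta> s = \<eta> s" if "s \<in> {0..1}" for s
    using that by (simp add: \<zeta>_def)
  have "bounded (\<eta> ` {0..1})"
    by (intro compact_imp_bounded compact_continuous_image \<eta>_cont) auto
  then obtain B where "\<forall>y\<in>\<eta> ` {0..1}. \<bar>y\<bar> \<le> B"
    unfolding bounded_real by auto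
  then have \<zeta>_bnd: "\<bar>\<zeta> s\<bar> \<le> B" for s
    by (simp add: \<zeta>_def)
  define h where "h z = snd z - \<zeta> (T z)" for z
  have h: "h \<in> borel_measurable P"
    unfolding h_def using snd measurable_compose[OF T \<zeta>] by measurable
  have h_bnd: "\<bar>h z\<bar> \<le> 1 + B" if "z \<in> space P" for z
    using labels[OF that] \<zeta>_bnd[of "T z"] by (auto simp: h_def)
  have orth: "(\<integral>z. \<phi> (T z) * h z \<partial>P) = 0"
    if "\<phi> \<in> borel_measurable borel" "\<And>s. \<bar>\<phi> s\<bar> \<le> K" for \<phi> K
    unfolding h_def T_def
    by (rule cond_label_prob_orthogonal[OF assms(1) f snd labels \<eta>_cond \<zeta> \<zeta>_eq \<zeta>_bnd that])

  define W where "W m = (\<Sum>r = 1..m. D r)" for m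
  have "filterlim W at_top sequentially"
    unfolding W_def by (rule assms(9))
  then have W_lim: "filterlim (\<lambda>n. W (k n)) at_top sequentially"
    by (rule filterlim_compose) (rule assms(11))

  have "(\<lambda>n. prob {\<omega> \<in> space M. \<epsilon> < \<bar>NDCG (cutoff (k n) D) \<sigma> n (\<lambda>i. Z i \<omega>) - \<eta> 1\<bar>}) \<longlonglongrightarrow> 0"
    if \<epsilon>: "0 < \<epsilon>" for \<epsilon>
  proof -
    \<comment> \<open>Half of \<open>\<epsilon>\<close> is reserved for the bias and half for the
      noise.\<close>
    obtain \<delta> where \<delta>: "0 < \<delta>" "\<And>s. dist s 1 < \<delta> \<Longrightarrow> dist (\<zeta> s) (\<zeta> 1) < \<epsilon> / 2"
      using \<zeta>_cont \<epsilon> unfolding continuous_on_iff by (metis UNIV_I half_gt_zero)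
    define A where "A = {z \<in> space P. 1 - \<delta> < T z}"
    define L where "L = {z \<in> space P. snd z = 1}"
    have A: "A \<in> sets P" and L: "L \<in> sets P"
      unfolding A_def L_def using T snd by measurable
    have A_pos: "0 < measure P A"
      unfolding A_def T_def using \<delta> by (intro canonical_gt_pos[OF assms(1) f f_atomless]) auto
    have L_pos: "0 < measure P L"
      unfolding L_def by (rule assms(3))
    \<comment> \<open>Three causes of failure: too few labels 1 (\<open>few L\<close>), too few
      scores near 1 (\<open>few A\<close>), and large noise (\<open>noisy\<close>).\<close>
    define few where "few Q n = {\<omega> \<in> space M. card {i \<in> {1..n}. Z i \<omega> \<in> Q} < k n}" for Q n
    define noisy where "noisy n = {\<omega> \<in> space M. \<epsilon> / 2 * W (k n)
        < \<bar>\<Sum>i = 1..n. cutoff (k n) D (score_rank n (\<lambda>i. T (Z i \<omega>)) i) * h (Z i \<omega>)\<bar>}" for n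
    let ?bad = "\<lambda>n. {\<omega> \<in> space M. \<epsilon> < \<bar>NDCG (cutoff (k n) D) \<sigma> n (\<lambda>i. Z i \<omega>) - \<eta> 1\<bar>}"
    have few_meas: "few Q n \<in> events" if Q: "Q \<in> sets P" for Q n
      unfolding few_def by (rule few_hits_in_events[OF Q])
    have noisy_meas: "noisy n \<in> events" for n
      unfolding noisy_def by (rule ranked_noise_in_events[OF T h])
    have pos: "\<forall>\<^sub>F n in sequentially. 0 < W (k n)"
      using W_lim by (simp add: filterlim_at_top_dense)
    \<comment> \<open>In particular \<open>k n <= n\<close> eventually, so the cutoff lies within
      the sample.\<close>
    have "\<forall>\<^sub>F n in sequentially. norm (real (k n)) \<le> 1 * norm (real n)"
      using landau_o.smallD[OF k_small, of 1] by simp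
    with pos have upper: "\<forall>\<^sub>F n in sequentially. prob (?bad n)
        \<le> prob (few L n) + prob (few A n) + (1 + B)\<^sup>2 * D 1 / (\<epsilon> / 2)\<^sup>2 / W (k n)"
    proof eventually_elim
      case (elim n)
      \<comment> \<open>Outside the three events the deterministic estimate applies, except on the
        null set where two canonical scores coincide.\<close>
      have "AE \<omega> in M. \<omega> \<in> ?bad n \<longrightarrow> \<omega> \<in> few L n \<union> few A n \<union> noisy n"
        using AE_inj_on_scores[OF T T_atomless, of n]
      proof eventually_elim
        case inj: (elim \<omega>)
        have "\<bar>NDCG (cutoff (k n) D) \<sigma> n (\<lambda>i. Z i \<omega>) - \<eta> 1\<bar> \<le> \<epsilon> / 2 + \<epsilon> / 2"
          if \<omega>: "\<omega> \<in> space M" and good: "\<omega> \<notin> few L n \<union> few A n \<union> noisy n"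
        proof (rule NDCG_cutoff_close[OF \<sigma>, where t = "\<lambda>i. T (Z i \<omega>)" and c = "1 - \<delta>" and \<zeta> = \<zeta>])
          have Z: "Z i \<omega> \<in> space P" if "i \<in> {1..n}" for i
            using that \<omega> by (intro measurable_space[OF measurable_Z]) auto
          show "fst (Z i \<omega>) \<in> space X" "snd (Z i \<omega>) \<in> {0, 1}" if "i \<in> {1..n}" for i
            using Z[OF that] by (auto simp: space_P)
          show "T (Z i \<omega>) \<le> T (Z j \<omega>)" if "f (fst (Z i \<omega>)) \<le> f (fst (Z j \<omega>))" for i j
            unfolding T_def by (rule canonical_mono[OF assms(1) f that])
          have "{i \<in> {1..n}. Z i \<omega> \<in> L} = {i \<in> {1..n}. snd (Z i \<omega>) = 1}"
            "{i \<in> {1..n}. Z i \<omega> \<in> A} = {i \<in> {1..n}. 1 - \<delta> < T (Z i \<omega>)}"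
            using Z by (auto simp: L_def A_def)
          then show "k n \<le> card {i \<in> {1..n}. snd (Z i \<omega>) = 1}"
            "k n \<le> card {i \<in> {1..n}. 1 - \<delta> < T (Z i \<omega>)}"
            using \<omega> good by (auto simp: few_def)
          \<comment> \<open>Scores never exceed 1, so the one-sided condition already puts them
            within \<open>\<delta>\<close> of 1.\<close>
          show "\<bar>\<zeta> (T (Z i \<omega>)) - \<eta> 1\<bar> \<le> \<epsilon> / 2" if "1 - \<delta> < T (Z i \<omega>)" for i
            using \<delta>(2)[of "T (Z i \<omega>)"] T_01[of "Z i \<omega>"] that \<zeta>_eq[of 1] by (auto simp: dist_real_def)
          show "\<bar>\<Sum>i = 1..n. cutoff (k n) D (score_rank n (\<lambda>i. T (Z i \<omega>)) i) * (snd (Z i \<omega>) - \<zeta> (T (Z i \<omega>)))\<bar>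
              \<le> \<epsilon> / 2 * (\<Sum>r = 1..k n. D r)"
            using \<omega> good by (auto simp: noisy_def h_def W_def)
          show "0 < (\<Sum>r = 1..k n. D r)"
            using elim by (simp add: W_def)
        qed (use inj D_nonneg in auto)
        then show ?case
          by fastforce
      qed
      then have "prob (?bad n) \<le> prob (few L n \<union> few A n \<union> noisy n)"
        using few_meas[OF L] few_meas[OF A] noisy_meas by (intro finite_measure_mono_AE) auto
      also have "\<dots> \<le> prob (few L n) + prob (few A n) + prob (noisy n)"
        using few_meas[OF L] few_meas[OF A] noisy_meas
        by (intro order_trans[OF measure_Un_le] add_right_mono measure_Un_le) auto
      also have "prob (noisy n) \<le> (1 + B)\<^sup>2 * D 1 / (\<epsilon> / 2)\<^sup>2 / W (k n)"
        unfolding noisy_def W_def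
        using elim \<epsilon> D_mono[OF order_refl]
        by (intro ranked_noise_tail[OF T h T_atomless h_bnd orth D_nonneg]) (auto simp: W_def)
      finally show ?case
        by simp
    qed
    \<comment> \<open>The two counts vanish because \<open>L\<close> and \<open>A\<close> have
      positive probability and \<open>k = o(n)\<close>; the noise bound vanishes because the
      discount sum diverges along \<open>k n\<close>.\<close>
    have "(\<lambda>n. prob (few L n) + prob (few A n) + (1 + B)\<^sup>2 * D 1 / (\<epsilon> / 2)\<^sup>2 / W (k n)) \<longlonglongrightarrow> 0 + 0 + 0"
      unfolding few_def
      by (intro tendsto_add few_hits_tendsto_0 A L A_pos L_pos k_small
          real_tendsto_divide_at_top[OF tendsto_const W_lim])
    then show ?thesis
      by (intro tendsto_sandwich[OF _ upper tendsto_const]) simp_all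
  qed
  then show ?thesis
    unfolding tendsto_in_prob_def using NDCG_meas by blast
qed

end
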